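(* Let $G$ be a group. Then the only power groups of $G$ are the subquotient groups of $G$ (that is, every power group of $G$ is a subquotient group of $G$) if and only if every $a \in G$ has finite order.
   Context: For subsets $A, B$ of a group $G$, the subset product is $AB = \{ab \mid a \in A,\ b \in B\}$. A power group of $G$ is a family $\mathcal{G} \subseteq \mathcal{P}(G) \setminus \{\emptyset\}$ of non-empty subsets of $G$ which is a group under the subset product (its identity element is some member of $\mathcal{G}$, not assumed to be $\{e\}$ or to contain the identity $e$ of $G$). A power group $\mathcal{G}$ of $G$ is a subquotient group (or subquotient) of $G$ if there exist a subgroup $H$ of $G$ and a normal subgroup $N$ of $H$ such that $\mathcal{G}$ consists precisely of the cosets of $N$ in $H$, i.e. $\mathcal{G} = H/N$. *)

theory Defs
  imports "HOL-Algebra.Multiplicative_Group"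
begin

text \<open>
  The identity \<open>E\<close> of a power group is existentially quantified: it is some member of the
  family (membership is part of \<^const>\<open>group\<close>) and need not contain the identity of \<open>G\<close>.
\<close>

definition power_group :: "('a, 'b) monoid_scheme \<Rightarrow> 'a set set \<Rightarrow> bool" where
  "power_group G F \<longleftrightarrow>
     F \<subseteq> Pow (carrier G) - {{}} \<and>
     (\<exists>E. group \<lparr>carrier = F, mult = (\<lambda>A B. A <#>\<^bsub>G\<^esub> B), one = E\<rparr>)"

definition subquotient_group :: "('a, 'b) monoid_scheme \<Rightarrow> 'a set set \<Rightarrow> bool" where
  "subquotient_group G F \<longleftrightarrow>
     power_group G F \<and>
     (\<exists>H N. subgroup H G \<and> N \<lhd> G\<lparr>carrier := H\<rparr> \<and>
            F = carrier (G\<lparr>carrier := H\<rparr> Mod N))"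

text \<open>\<^const>\<open>group.ord\<close> takes the value \<open>0\<close> exactly on the elements of infinite order.\<close>

definition finite_order :: "('a, 'b) monoid_scheme \<Rightarrow> 'a \<Rightarrow> bool" where
  "finite_order G a \<longleftrightarrow> group.ord G a \<noteq> 0"

end

theory Submission
  imports Defs
begin

text \<open>
  If \<open>a\<close> has infinite order, the family whose only member is \<open>{a\<^sup>n | n \<ge> 0}\<close> is a trivial power
  group, but a subquotient would force that member to be a subgroup. Conversely, in a torsion group
  non-empty multiplicatively closed subsets are subgroups. Hence the identity \<open>E\<close> of a power
  group and the union \<open>H\<close> of its members are subgroups, and \<open>E a = A = a E\<close> for every \<open>a \<in> A\<close>,
  so \<open>E\<close> is normal in \<open>H\<close> and the members are its cosets.
\<close>

context group
begin

text \<open>The inverse of an element of finite order is a positive power of it, so closure under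
  products already gives closure under inverses.\<close>

lemma subgroup_if_torsion:
  assumes "H \<subseteq> carrier G" "H \<noteq> {}"
    and closed: "\<And>x y. x \<in> H \<Longrightarrow> y \<in> H \<Longrightarrow> x \<otimes> y \<in> H"
    and torsion: "\<And>x. x \<in> H \<Longrightarrow> ord x \<noteq> 0"
  shows "subgroup H G"
proof (rule subgroupI)
  fix x assume x: "x \<in> H"
  then have xG: "x \<in> carrier G" using assms(1) by blast
  have pow: "x [^] Suc n \<in> H" for n
    by (induction n) (use x xG closed in auto)
  \<comment> \<open>The exponent \<open>2 * ord x - 1\<close> is positive even for \<open>ord x = 1\<close>, unlike \<open>ord x - 1\<close>.\<close>
  define m where "m = 2 * ord x - 2"
  have "Suc (Suc m) = ord x * 2"
    using torsion[OF x] unfolding m_def by linarith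
  then have "x [^] Suc (Suc m) = \<one>"
    using xG by (metis nat_pow_one nat_pow_pow pow_ord_eq_1)
  then have "inv x = x [^] Suc m"
    using xG by (metis inv_equality nat_pow_Suc nat_pow_closed)
  with pow show "inv x \<in> H" by simp
qed (use assms in auto)

text \<open>Exponents add, and the exponent \<open>0\<close> puts \<open>\<one>\<close> into the
  set, so every power is a product of two powers. This idempotence makes the set the identity of a
  one-element power group.\<close>

lemma powers_idem:
  assumes "a \<in> carrier G"
  shows "range (\<lambda>n::nat. a [^] n) <#> range (\<lambda>n::nat. a [^] n) = range (\<lambda>n::nat. a [^] n)"
proof
  show "range (\<lambda>n::nat. a [^] n) \<subseteq> range (\<lambda>n::nat. a [^] n) <#> range (\<lambda>n::nat. a [^] n)"
  proof
    fix x assume "x \<in> range (\<lambda>n::nat. a [^] n)"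
    then obtain n :: nat where "x = a [^] n" by blast
    then have "x = a [^] n \<otimes> a [^] (0::nat)" using assms by simp
    then show "x \<in> range (\<lambda>n::nat. a [^] n) <#> range (\<lambda>n::nat. a [^] n)"
      unfolding set_mult_def by blast
  qed
qed (use assms in \<open>auto simp: set_mult_def nat_pow_mult\<close>)

lemma power_group_singleton:
  assumes "E \<subseteq> carrier G" "E \<noteq> {}" "E <#> E = E"
  shows "power_group G {E}"
  unfolding power_group_def
proof
  show "\<exists>E'. group \<lparr>carrier = {E}, mult = (\<lambda>A B. A <#> B), one = E'\<rparr>"
    by (rule exI[of _ E], rule groupI) (use assms in auto)
qed (use assms in auto)

text \<open>The identity of \<open>H/N\<close> is \<open>N\<close> itself, so the only member
  \<open>E\<close> must equal \<open>N\<close>, a subgroup of \<open>H\<close> and hence of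
  \<open>G\<close>.\<close>

lemma subquotient_singleton_imp_subgroup:
  assumes "subquotient_group G {E}"
  shows "subgroup E G"
proof -
  obtain H N where H: "subgroup H G" and N: "N \<lhd> G\<lparr>carrier := H\<rparr>"
    and F: "{E} = carrier (G\<lparr>carrier := H\<rparr> Mod N)"
    using assms unfolding subquotient_group_def by auto
  interpret N: normal N "G\<lparr>carrier := H\<rparr>" by (fact N)
  have "N \<in> carrier (G\<lparr>carrier := H\<rparr> Mod N)"
    using group.is_monoid[OF N.factorgroup_is_group] monoid.one_closed one_FactGroup by metis
  with F have "N = E" by auto
  then show ?thesis
    using incl_subgroup[OF H N.subgroup_axioms] by simp
qed

text \<open>If the inverse of \<open>a\<close> were \<open>a [^] n\<close> with
  \<open>n \<ge> 0\<close>, then \<open>a\<close> would have the positive exponent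
  \<open>Suc n\<close>, contradicting infinite order.\<close>

lemma not_subgroup_powers:
  assumes "a \<in> carrier G" "ord a = 0"
  shows "\<not> subgroup (range (\<lambda>n::nat. a [^] n)) G"
proof
  assume "subgroup (range (\<lambda>n::nat. a [^] n)) G"
  moreover have "a \<in> range (\<lambda>n::nat. a [^] n)"
    using assms(1) by (intro image_eqI[of _ _ "1::nat"]) auto
  ultimately have "inv a \<in> range (\<lambda>n::nat. a [^] n)"
    by (rule subgroup.m_inv_closed)
  then obtain n :: nat where "inv a = a [^] n" by (rule rangeE)
  then have "a [^] Suc n = \<one>"
    using assms(1) by (metis l_inv nat_pow_Suc)
  then show False using assms pow_eq_id[of a "Suc n"] by simp
qed

lemma power_group_imp_subquotient_if_torsion:
  assumes F: "power_group G F" and torsion: "\<And>x. x \<in> carrier G \<Longrightarrow> ord x \<noteq> 0"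
  shows "subquotient_group G F"
proof -
  obtain E where sub: "F \<subseteq> Pow (carrier G) - {{}}"
    and grp: "group \<lparr>carrier = F, mult = (\<lambda>A B. A <#> B), one = E\<rparr>"
    using F unfolding power_group_def by blast
  interpret P: group "\<lparr>carrier = F, mult = (\<lambda>A B. A <#> B), one = E\<rparr>" by (fact grp)
  have EF: "E \<in> F" using P.one_closed by simp
  have prod: "A <#> B \<in> F" if "A \<in> F" "B \<in> F" for A B using P.m_closed that by simp
  have lE: "E <#> A = A" and rE: "A <#> E = A" if "A \<in> F" for A
    using P.l_one P.r_one that by simp_all
  have ex_inv: "\<exists>B\<in>F. A <#> B = E \<and> B <#> A = E" if "A \<in> F" for A
    using P.l_inv[of A] P.r_inv[of A] P.inv_closed[of A] that by auto
  have mem: "x \<otimes> y \<in> A <#> B" if "x \<in> A" "y \<in> B" for x y A B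
    using that unfolding set_mult_def by blast
  have carr: "x \<in> carrier G" if "x \<in> A" "A \<in> F" for x A using that sub by blast
  have E: "subgroup E G"
  proof (rule subgroup_if_torsion)
    show "x \<otimes> y \<in> E" if "x \<in> E" "y \<in> E" for x y
      using mem[OF that] lE[OF EF] by simp
  qed (use sub EF torsion in blast)+
  define H where "H = \<Union>F"
  have H: "subgroup H G"
  proof (rule subgroup_if_torsion)
    \<comment> \<open>Members \<open>A\<close> and \<open>B\<close> containing \<open>x\<close> and
      \<open>y\<close> give the product a place in \<open>A <#> B\<close>, again a member of
      \<open>F\<close>.\<close>
    show "x \<otimes> y \<in> H" if "x \<in> H" "y \<in> H" for x y
      using that mem prod unfolding H_def by blast
  qed (use sub EF torsion in \<open>unfold H_def, blast+\<close>)
  have coset: "E #> a = A \<and> a <# E = A" if a: "a \<in> A" and A: "A \<in> F" for a A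
  proof -
    \<comment> \<open>An element \<open>b\<close> of the inverse member \<open>B\<close> moves
      elements of \<open>A\<close> into the subgroup \<open>E\<close>, where inverses can be
      taken.\<close>
    obtain B where B: "B \<in> F" "A <#> B = E" "B <#> A = E" using ex_inv[OF A] by blast
    then obtain b where b: "b \<in> B" using sub by blast
    have aG: "a \<in> carrier G" and bG: "b \<in> carrier G" using carr a b A B(1) by auto
    have "E #> a \<subseteq> A" using mem[of _ E a A] a lE[OF A] unfolding r_coset_def by blast
    moreover have "a <# E \<subseteq> A" using mem[of a A _ E] a rE[OF A] unfolding l_coset_def by blast
    \<comment> \<open>Both \<open>x \<otimes> b\<close> and \<open>a \<otimes> b\<close> lie in
      \<open>E\<close>; their quotient is the factor that carries \<open>a\<close> to
      \<open>x\<close>.\<close>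
    moreover have "x \<in> E #> a" if x: "x \<in> A" for x
    proof -
      have xG: "x \<in> carrier G" using carr x A by blast
      have "x \<otimes> b \<in> E" "a \<otimes> b \<in> E" using mem x a b B by blast+
      then have "(x \<otimes> b) \<otimes> inv (a \<otimes> b) \<in> E"
        using E by (simp add: subgroup.m_closed subgroup.m_inv_closed)
      moreover have "(x \<otimes> b) \<otimes> inv (a \<otimes> b) \<otimes> a = x"
        using xG aG bG by (simp add: inv_mult_group m_assoc)
      ultimately show ?thesis unfolding r_coset_def by force
    qed
    \<comment> \<open>The mirror image: \<open>b\<close> now multiplies from the left, using
      \<open>B <#> A = E\<close>.\<close>
    moreover have "x \<in> a <# E" if x: "x \<in> A" for x
    proof -
      have xG: "x \<in> carrier G" using carr x A by blast
      have "b \<otimes> x \<in> E" "b \<otimes> a \<in> E" using mem x a b B by blast+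
      then have "inv (b \<otimes> a) \<otimes> (b \<otimes> x) \<in> E"
        using E by (simp add: subgroup.m_closed subgroup.m_inv_closed)
      moreover have "a \<otimes> (inv (b \<otimes> a) \<otimes> (b \<otimes> x)) = x"
        using xG aG bG by (simp add: inv_mult_group flip: m_assoc)
      ultimately show ?thesis unfolding l_coset_def by force
    qed
    ultimately show ?thesis by blast
  qed
  \<comment> \<open>Cosets depend only on the multiplication, which restricting the carrier to
    \<open>H\<close> leaves unchanged.\<close>
  have coset_H: "E #>\<^bsub>G\<lparr>carrier := H\<rparr>\<^esub> a = E #> a" "a <#\<^bsub>G\<lparr>carrier := H\<rparr>\<^esub> E = a <# E" for a
    unfolding r_coset_def l_coset_def by simp_all
  have "E \<lhd> G\<lparr>carrier := H\<rparr>"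
  proof (rule group.normalI)
    show "group (G\<lparr>carrier := H\<rparr>)" using H subgroup_imp_group by blast
    show "subgroup E (G\<lparr>carrier := H\<rparr>)"
      using subgroup_incl[OF E H] EF unfolding H_def by blast
    \<comment> \<open>Both cosets of \<open>x\<close> equal any member of \<open>F\<close> that
      contains \<open>x\<close>.\<close>
    show "\<forall>x\<in>carrier (G\<lparr>carrier := H\<rparr>).
        E #>\<^bsub>G\<lparr>carrier := H\<rparr>\<^esub> x = x <#\<^bsub>G\<lparr>carrier := H\<rparr>\<^esub> E"
      using coset unfolding coset_H H_def by auto
  qed
  moreover have "F = carrier (G\<lparr>carrier := H\<rparr> Mod E)"
  proof -
    \<comment> \<open>Members are non-empty, so each has a representative \<open>a\<close> and is
      the coset \<open>E #> a\<close>.\<close>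
    have "F = (\<lambda>a. E #> a) ` \<Union>F"
    proof (intro equalityI subsetI)
      fix A assume A: "A \<in> F"
      then obtain a where "a \<in> A" using sub by blast
      with A coset show "A \<in> (\<lambda>a. E #> a) ` \<Union>F" by blast
    qed (use coset in auto)
    then show ?thesis unfolding carrier_FactGroup coset_H H_def by simp
  qed
  ultimately show ?thesis unfolding subquotient_group_def using F H by blast
qed

end

theorem theorem2:
  fixes G :: "('a, 'b) monoid_scheme"
  assumes "group G"
  shows "(\<forall>F. power_group G F \<longrightarrow> subquotient_group G F) \<longleftrightarrow>
         (\<forall>a\<in>carrier G. finite_order G a)"
proof -
  interpret group G by (fact assms)
  show ?thesis
  proof
    assume all: "\<forall>F. power_group G F \<longrightarrow> subquotient_group G F"
    show "\<forall>a\<in>carrier G. finite_order G a"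
      unfolding finite_order_def
    proof (intro ballI notI)
      fix a assume a: "a \<in> carrier G" "ord a = 0"
      have "power_group G {range (\<lambda>n::nat. a [^]\<^bsub>G\<^esub> n)}"
        using a(1) powers_idem by (intro power_group_singleton) auto
      with all have "subgroup (range (\<lambda>n::nat. a [^]\<^bsub>G\<^esub> n)) G"
        using subquotient_singleton_imp_subgroup by blast
      with not_subgroup_powers a show False by blast
    qed
  next
    assume "\<forall>a\<in>carrier G. finite_order G a"
    then show "\<forall>F. power_group G F \<longrightarrow> subquotient_group G F"
      unfolding finite_order_def using power_group_imp_subquotient_if_torsion by blast
  qed
qed

end
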